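(* Let $f: \mathbf{N} \to \mathbf{Z}$ be a nonzero function and let $(f_j)_{j=1}^{\infty}$ be the sequence of functions $\mathbf{N} \to \mathbf{Z}$ with $f_1 = f$ produced by the inductive construction described in the context. (1) If $f_j$ is the constant function $-1$ for some $j$, then $f$ is not the fixed point counting function of a permutation. (2) If $f_j$ is the zero function for some $j$, and if $r$ is the smallest positive integer such that $f_r$ is the zero function, then there are finite sequences of positive integers $(\ell_j)_{j=1}^{r-1}$ and $(q_j)_{j=1}^{r-1}$ (those produced by the construction) such that $(\ell_j)_{j=1}^{r-1}$ is strictly increasing and $f$ is the fixed point counting function of a permutation $\sigma$ of a nonempty finite set $X$ with \[ |X| = \sum_{j=1}^{r-1} q_j \ell_j \quad\text{and}\quad C_\sigma(\ell_j) = q_j \text{ for } j \in \{1,\ldots,r-1\}. \] (3) If, for every $j \in \mathbf{N}$, $f_j$ is neither the zero function nor the constant function $-1$, then $(f_j)_{j=1}^\infty$ is an infinite sequence of nonzero nonnegative functions, and there are infinite sequences of positive integers $(\ell_j)_{j=1}^{\infty}$ and $(q_j)_{j=1}^{\infty}$ (those produced by the construction) such that $(\ell_j)_{j=1}^{\infty}$ is strictly increasing and $f$ is the fixed point counting function of a permutation $\sigma$ of a countably infinite set $X$ with \[ C_\sigma(\ell_j) = q_j \quad \text{for all } j \in \mathbf{N} \] and $C_\sigma(k) = 0$ for all $k \in \mathbf{N}$ such that $k \neq \ell_j$ for all $j \in \mathbf{N}$.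
   Context: $\mathbf{N} = \{1,2,3,\ldots\}$. For a nonempty finite or countably infinite set $X$ and a permutation $\sigma$ of $X$, $F_X(\sigma^k)$ is the number of $x \in X$ with $\sigma^k(x)=x$, and $f$ is the fixed point counting function of $\sigma$ if $f(k) = F_X(\sigma^k)$ for all $k \in \mathbf{N}$. $C_\sigma(\ell)$ is the number of cycles of length $\ell$ in the decomposition of $\sigma$ into pairwise disjoint cycles (fixed points being cycles of length $1$). A function on $\mathbf{N}$ is nonzero if it takes a nonzero value somewhere, and nonnegative if all its values are $\geq 0$. Inductive construction. Set $f_1 = f$. Given $f_j: \mathbf{N} \to \mathbf{Z}$, define $f_{j+1}$ as follows. (i) If $f_j(k) < 0$ for some $k \in \mathbf{N}$, then $f_{j+1}$ is the constant function $-1$. (ii) If $f_j$ is the zero function, then $f_{j+1}$ is the zero function. (iii) If $f_j$ is nonzero and nonnegative, let $\ell_j$ be the smallest positive integer such that $f_j(\ell_j) > 0$. (a) If $f_j(\ell_j) \not\equiv 0 \pmod{\ell_j}$, then $f_{j+1}$ is the constant function $-1$. (b) If $f_j(\ell_j) \equiv 0 \pmod{\ell_j}$, write $f_j(\ell_j) = q_j \ell_j$ with $q_j$ a positive integer. If $f_j(d\ell_j) - q_j\ell_j < 0$ for some $d \in \mathbf{N}$, then $f_{j+1}$ is the constant function $-1$. If $f_j(d\ell_j) - q_j\ell_j \geq 0$ for all $d \in \mathbf{N}$, then $f_{j+1}(k) = f_j(k) - q_j\ell_j$ if $k \equiv 0 \pmod{\ell_j}$ and $f_{j+1}(k) = f_j(k)$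 if $k \not\equiv 0 \pmod{\ell_j}$. *)

theory Defs
  imports
    "HOL-Library.Extended_Nat"
    "HOL-Library.Countable_Set"
    "HOL-Combinatorics.Orbits"
begin

text \<open>
  A function on the positive integers is represented by a function on all of \<open>nat\<close> whose value
  at \<open>0\<close> is ignored; every quantifier over arguments is restricted to positive numbers.
\<close>

definition zero_fun :: "(nat \<Rightarrow> int) \<Rightarrow> bool" where
  "zero_fun f \<longleftrightarrow> (\<forall>k\<ge>1. f k = 0)"

definition neg_one_fun :: "(nat \<Rightarrow> int) \<Rightarrow> bool" where
  "neg_one_fun f \<longleftrightarrow> (\<forall>k\<ge>1. f k = -1)"

definition nonzero_fun :: "(nat \<Rightarrow> int) \<Rightarrow> bool" where
  "nonzero_fun f \<longleftrightarrow> (\<exists>k\<ge>1. f k \<noteq> 0)"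

definition nonneg_fun :: "(nat \<Rightarrow> int) \<Rightarrow> bool" where
  "nonneg_fun f \<longleftrightarrow> (\<forall>k\<ge>1. f k \<ge> 0)"

text \<open>
  The number of elements of a possibly infinite set. The library's \<open>card\<close> is \<open>0\<close> on infinite
  sets, so it cannot be used directly for numbers of fixed points or of cycles.
\<close>

definition ecard :: "'a set \<Rightarrow> enat" where
  "ecard A = (if finite A then enat (card A) else \<infinity>)"

definition num_fixpoints :: "'a set \<Rightarrow> ('a \<Rightarrow> 'a) \<Rightarrow> enat" where
  "num_fixpoints X g = ecard {x \<in> X. g x = x}"

definition fixed_point_counting_fun ::
  "(nat \<Rightarrow> int) \<Rightarrow> 'a set \<Rightarrow> ('a \<Rightarrow> 'a) \<Rightarrow> bool" where
  "fixed_point_counting_fun f X \<sigma> \<longleftrightarrow>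
     X \<noteq> {} \<and> countable X \<and> \<sigma> permutes X \<and>
     (\<forall>k\<ge>1. \<exists>n. num_fixpoints X (\<sigma> ^^ k) = enat n \<and> f k = int n)"

text \<open>
  Cycles are identified with their underlying sets (singletons for fixed points). A set satisfying \<open>cyclic_on\<close> is always finite, so
  infinite orbits are not counted for any length.
\<close>

definition num_cycles :: "'a set \<Rightarrow> ('a \<Rightarrow> 'a) \<Rightarrow> nat \<Rightarrow> enat" where
  "num_cycles X \<sigma> l = ecard {S. S \<subseteq> X \<and> cyclic_on \<sigma> S \<and> card S = l}"

definition least_pos :: "(nat \<Rightarrow> int) \<Rightarrow> nat" where
  "least_pos f = (LEAST l. l \<ge> 1 \<and> f l > 0)"

definition step :: "(nat \<Rightarrow> int) \<Rightarrow> nat \<Rightarrow> int" where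
  "step f =
    (if \<exists>k\<ge>1. f k < 0 then (\<lambda>_. -1)
     else if zero_fun f then (\<lambda>_. 0)
     else
       let l = least_pos f in
       if f l mod int l \<noteq> 0 then (\<lambda>_. -1)
       else
         let q = f l div int l in
         if \<exists>d\<ge>1. f (d * l) - q * int l < 0 then (\<lambda>_. -1)
         else (\<lambda>k. if k mod l = 0 then f k - q * int l else f k))"

text \<open>The sequence is indexed from \<open>1\<close>; the index \<open>0\<close> carries no meaning.\<close>

definition fseq :: "(nat \<Rightarrow> int) \<Rightarrow> nat \<Rightarrow> nat \<Rightarrow> int" where
  "fseq f j = (step ^^ (j - 1)) f"

text \<open>
  The numbers \<open>l\<close> and \<open>q\<close> that the construction attaches to a function falling into its
  case (iii)(b).
\<close>

definition produces :: "(nat \<Rightarrow> int) \<Rightarrow> nat \<Rightarrow> nat \<Rightarrow> bool" where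
  "produces f l q \<longleftrightarrow>
     nonzero_fun f \<and> nonneg_fun f \<and> l = least_pos f \<and> q \<ge> 1 \<and> f l = int q * int l"

end

theory Submission
  imports Defs
begin

text \<open>
  A point fixed by \<open>\<sigma>\<^sup>k\<close> lies on a cycle of length dividing \<open>k\<close>, so \<open>f\<close> counts fixed points of
  a permutation exactly if \<open>f k = (\<Sum>d | d dvd k. d * c d)\<close> for some nonnegative integers \<open>c d\<close>.
  The least \<open>l\<close> with \<open>f l > 0\<close> is then the least \<open>l\<close> with \<open>c l > 0\<close>, and \<open>f l = l * c l\<close>: one
  step of the construction replaces \<open>c l\<close> by \<open>0\<close> and hence never fails on such an \<open>f\<close>. Conversely, a
  construction that does not fail peels off all the pairs \<open>(l, q)\<close>, and a union of
  \<open>q\<close> rotations of \<open>l\<close> points for each of them realises \<open>f\<close>.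
\<close>

section \<open>Fixed points and cycles\<close>

lemma ecard_finite: "finite A \<Longrightarrow> ecard A = enat (card A)"
  by (simp add: ecard_def)

lemma ecard_eq_enatD: "ecard A = enat n \<Longrightarrow> finite A \<and> card A = n"
  by (auto simp: ecard_def split: if_splits)

text \<open>\<open>f\<close> runs through \<open>S\<close> in a single cycle, so the first return
  time \<open>p\<close> of \<open>x\<close> equals \<open>card S\<close>. The point
  \<open>(f ^^ k) x\<close> depends only on \<open>k mod p\<close>, and no exponent strictly between
  0 and \<open>p\<close> leads back to \<open>x\<close>.\<close>

lemma cyclic_on_funpow_eq_iff:
  assumes "cyclic_on f S" "x \<in> S"
  shows "(f ^^ k) x = x \<longleftrightarrow> card S dvd k"
proof -
  have S: "S = orbit f x" "x \<in> orbit f x"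
    using orbit_cyclic_eq3[OF assms] assms(2) by simp_all
  define p where "p = funpow_dist1 f x x"
  have p: "(f ^^ p) x = x" "p > 0"
    using funpow_dist1_prop[OF S(2)] by (simp_all add: p_def)
  have "card S = p"
    unfolding S(1) orbit_conv_funpow_dist1[OF S(2)] p_def
    by (subst card_image[OF inj_on_funpow_dist1[OF S(2)]]) simp
  moreover have "(f ^^ k) x = (f ^^ (k mod p)) x"
    using funpow_mod_eq[OF p(1)] by simp
  moreover have "(f ^^ m) x \<noteq> x" if "0 < m" "m < p" for m
    using funpow_dist1_least[of m f x x] that by (simp add: p_def)
  ultimately show ?thesis
    using p(2) by (cases "k mod p = 0") (auto simp: dvd_eq_mod_eq_0)
qed

text \<open>A point fixed by a positive power returns to itself, so its orbit is a finite cycle. For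
  \<open>k = 0\<close> the points on infinite orbits would be fixed too, without lying on any
  cycle.\<close>

lemma funpow_fixpoints_eq_Union_cycles:
  assumes "\<sigma> permutes X" "k > 0"
  shows "{x \<in> X. (\<sigma> ^^ k) x = x} = \<Union>{S. S \<subseteq> X \<and> cyclic_on \<sigma> S \<and> card S dvd k}"
proof (intro set_eqI iffI)
  fix x assume x: "x \<in> {x \<in> X. (\<sigma> ^^ k) x = x}"
  \<comment> \<open>\<open>orbit\<close> starts at \<open>\<sigma> x\<close> and not at
    \<open>x\<close>, so this membership records a return after a positive number of steps.\<close>
  hence self: "x \<in> orbit \<sigma> x"
    using assms(2) by (auto simp: orbit_altdef) metis
  hence cyc: "cyclic_on \<sigma> (orbit \<sigma> x)"
    by (auto simp: cyclic_on_def)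
  moreover have "orbit \<sigma> x \<subseteq> X"
    using permutes_orbit_subset[OF assms(1)] x by simp
  moreover have "card (orbit \<sigma> x) dvd k"
    using cyclic_on_funpow_eq_iff[OF cyc self] x by simp
  ultimately show "x \<in> \<Union>{S. S \<subseteq> X \<and> cyclic_on \<sigma> S \<and> card S dvd k}"
    using self by blast
qed (auto simp: cyclic_on_funpow_eq_iff)

text \<open>A cycle is the orbit of each of its points, so a common point identifies two
  cycles.\<close>

lemma cyclic_on_disjoint:
  "cyclic_on f S \<Longrightarrow> cyclic_on f T \<Longrightarrow> S \<noteq> T \<Longrightarrow> S \<inter> T = {}"
  by (metis disjoint_iff orbit_cyclic_eq3)

text \<open>\<open>c d\<close> is the number of cycles of length \<open>d\<close>: the cycles of
  length dividing \<open>k\<close> partition the fixed points of the \<open>k\<close>-th power and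
  are then grouped by length.\<close>

lemma fixed_point_counting_fun_eq_divisor_sum:
  assumes "fixed_point_counting_fun f X \<sigma>"
  obtains c :: "nat \<Rightarrow> nat" where "\<And>k. k \<ge> 1 \<Longrightarrow> f k = int (\<Sum>d | d dvd k. d * c d)"
proof
  define C where "C P = {S. S \<subseteq> X \<and> cyclic_on \<sigma> S \<and> P (card S)}" for P
  fix k :: nat assume k: "k \<ge> 1"
  from assms have \<sigma>: "\<sigma> permutes X"
    by (simp add: fixed_point_counting_fun_def)
  define F where "F = {x \<in> X. (\<sigma> ^^ k) x = x}"
  have fin: "finite F" and f: "f k = int (card F)"
    using assms k ecard_eq_enatD
    unfolding fixed_point_counting_fun_def num_fixpoints_def F_def by (metis (lifting))+
  have F: "F = \<Union>(C (\<lambda>d. d dvd k))"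
    using funpow_fixpoints_eq_Union_cycles[OF \<sigma>, of k] k by (simp add: F_def C_def)
  \<comment> \<open>The union \<open>F\<close> of these cycles is finite, so there are finitely many
    of them, and each \<open>card\<close> below is a true count and not the default 0.\<close>
  have finC: "finite (C (\<lambda>d. d dvd k))"
    using fin F finite_UnionD by simp
  have "card F = (\<Sum>S\<in>C (\<lambda>d. d dvd k). card S)"
    unfolding F using finite_cyclic_on cyclic_on_disjoint
    by (intro card_Union_disjoint) (fastforce simp: C_def pairwise_def disjnt_def)+
  also have "\<dots> = (\<Sum>d | d dvd k. \<Sum>S | S \<in> C (\<lambda>d. d dvd k) \<and> card S = d. card S)"
    using finC k by (intro sum.group[symmetric]) (auto simp: C_def)
  also have "\<dots> = (\<Sum>d | d dvd k. d * card (C (\<lambda>n. n = d)))"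
  proof (rule sum.cong)
    fix d assume "d \<in> {d. d dvd k}"
    hence "{S. S \<in> C (\<lambda>d. d dvd k) \<and> card S = d} = C (\<lambda>n. n = d)"
      by (auto simp: C_def)
    moreover have "(\<Sum>S\<in>C (\<lambda>n. n = d). card S) = d * card (C (\<lambda>n. n = d))"
      by (simp add: C_def)
    ultimately show "(\<Sum>S | S \<in> C (\<lambda>d. d dvd k) \<and> card S = d. card S) = d * card (C (\<lambda>n. n = d))"
      by simp
  qed simp
  finally show "f k = int (\<Sum>d | d dvd k. d * card {S. S \<subseteq> X \<and> cyclic_on \<sigma> S \<and> card S = d})"
    using f by (simp add: C_def)
qed

section \<open>The construction\<close>

lemma least_posI:
  assumes "nonzero_fun f" "nonneg_fun f"
  shows "least_pos f \<ge> 1" "f (least_pos f) > 0"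
proof -
  obtain k where "k \<ge> 1 \<and> f k > 0"
    using assms by (metis nonneg_fun_def nonzero_fun_def order_less_le)
  hence "least_pos f \<ge> 1 \<and> f (least_pos f) > 0"
    unfolding least_pos_def by (rule LeastI)
  thus "least_pos f \<ge> 1" "f (least_pos f) > 0" by simp_all
qed

lemma eq_0_if_less_least_pos:
  assumes "nonneg_fun f" "k \<ge> 1" "k < least_pos f"
  shows "f k = 0"
  using assms not_less_Least[of k "\<lambda>l. l \<ge> 1 \<and> f l > 0"]
  by (auto simp: nonneg_fun_def least_pos_def order_less_le)

text \<open>Erasing the coefficient at the least length keeps the divisor-sum form, which is
  therefore an invariant of the construction.\<close>

lemma step_divisor_sum:
  fixes c :: "nat \<Rightarrow> nat"
  assumes f: "\<And>k. k \<ge> 1 \<Longrightarrow> f k = int (\<Sum>d | d dvd k. d * c d)"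
  obtains c' :: "nat \<Rightarrow> nat" where "\<And>k. k \<ge> 1 \<Longrightarrow> step f k = int (\<Sum>d | d dvd k. d * c' d)"
proof (cases "zero_fun f")
  case True
  hence "step f k = int (\<Sum>d | d dvd k. d * 0)" for k
    by (auto simp: step_def zero_fun_def)
  with that[of "\<lambda>_. 0"] show ?thesis by simp
next
  case False
  have nonneg: "nonneg_fun f"
    unfolding nonneg_fun_def using f by (metis of_nat_0_le_iff)
  have nonzero: "nonzero_fun f"
    using False by (simp add: nonzero_fun_def zero_fun_def)
  define l where "l = least_pos f"
  note l = least_posI[OF nonzero nonneg, folded l_def]
  \<comment> \<open>By minimality of \<open>l\<close>, \<open>f\<close> vanishes at its proper
    divisors. A vanishing sum of natural numbers has only zero terms, among them the one at
    \<open>e = d\<close>.\<close>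
  have c0: "d * c d = 0" if "d dvd l" "d \<noteq> l" for d
  proof -
    have d: "d \<ge> 1" "d < l"
      using that l(1) dvd_imp_le[OF that(1)] by (cases "d = 0"; simp)+
    hence "(\<Sum>e | e dvd d. e * c e) = 0"
      using eq_0_if_less_least_pos[OF nonneg d(1)] f[OF d(1)] unfolding l_def by linarith
    moreover have "finite {e. e dvd d}" using d(1) by simp
    ultimately have "\<forall>e\<in>{e. e dvd d}. e * c e = 0" by (simp only: sum_eq_0_iff)
    thus ?thesis by (metis dvd_refl mem_Collect_eq)
  qed
  have fl: "f l = int (c l) * int l"
  proof -
    have "(\<Sum>d | d dvd l. d * c d) = (\<Sum>d\<in>{l}. d * c d)"
      using l(1) c0 by (intro sum.mono_neutral_right) auto
    thus ?thesis using f[OF l(1)] by simp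
  qed
  have sub: "f k - int (c l) * int l = int (\<Sum>d | d dvd k. d * (c(l := 0)) d)"
    if "k \<ge> 1" "l dvd k" for k
  proof -
    have fin: "finite {d. d dvd k}" using that by simp
    have "(\<Sum>d | d dvd k. d * c d) = l * c l + (\<Sum>d\<in>{d. d dvd k} - {l}. d * c d)"
      using that fin by (intro sum.remove) auto
    moreover have "(\<Sum>d | d dvd k. d * (c(l := 0)) d) =
        l * (c(l := 0)) l + (\<Sum>d\<in>{d. d dvd k} - {l}. d * (c(l := 0)) d)"
      using that fin by (intro sum.remove) auto
    ultimately show ?thesis using f[OF that(1)] by simp
  qed
  \<comment> \<open>By \<open>sub\<close>, each difference is again a sum of natural numbers, so the
    subtraction cannot fail.\<close>
  have ok: "\<not> (\<exists>d\<ge>1. f (d * l) - f l div int l * int l < 0)"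
  proof -
    have "f (d * l) - f l div int l * int l \<ge> 0" if "d \<ge> 1" for d
    proof -
      have "f l div int l * int l = int (c l) * int l" using fl l(1) by simp
      moreover have "f (d * l) - int (c l) * int l \<ge> 0"
        using that l(1) by (subst sub) (auto simp del: of_nat_sum)
      ultimately show ?thesis by linarith
    qed
    thus ?thesis by (meson not_less)
  qed
  have "step f k = int (\<Sum>d | d dvd k. d * (c(l := 0)) d)" if k: "k \<ge> 1" for k
  proof -
    have "step f k = (if k mod l = 0 then f k - f l div int l * int l else f k)"
      using nonneg False fl ok unfolding step_def nonneg_fun_def l_def[symmetric] Let_def
      by (auto simp: not_less)
    moreover have "(\<Sum>d | d dvd k. d * (c(l := 0)) d) = (\<Sum>d | d dvd k. d * c d)" if "\<not> l dvd k"
      using that by (intro sum.cong) auto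
    moreover have "f l div int l * int l = int (c l) * int l" using fl l(1) by simp
    ultimately show ?thesis
      using sub[OF k] f[OF k] by (cases "l dvd k") (auto simp del: of_nat_sum fun_upd_apply simp flip: dvd_eq_mod_eq_0)
  qed
  with that show ?thesis by blast
qed

lemma fseq_1: "fseq f (Suc 0) = f"
  by (simp add: fseq_def)

lemma fseq_Suc: "j \<ge> 1 \<Longrightarrow> fseq f (Suc j) = step (fseq f j)"
  by (cases j) (simp_all add: fseq_def)

text \<open>The divisor-sum form passes from each stage to the next and makes the value at 1
  nonnegative.\<close>

lemma fixed_point_counting_fun_imp_not_neg_one_fun:
  assumes "fixed_point_counting_fun f X \<sigma>" "j \<ge> 1"
  shows "\<not> neg_one_fun (fseq f j)"
proof -
  have "\<exists>c :: nat \<Rightarrow> nat. \<forall>k\<ge>1. fseq f j k = int (\<Sum>d | d dvd k. d * c d)"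
    using assms(2)
  proof (induction rule: dec_induct)
    case base
    show ?case
      using fixed_point_counting_fun_eq_divisor_sum[OF assms(1)] by (metis One_nat_def fseq_1)
  next
    case (step j)
    then obtain c :: "nat \<Rightarrow> nat"
      where c: "\<And>k. k \<ge> 1 \<Longrightarrow> fseq f j k = int (\<Sum>d | d dvd k. d * c d)" by blast
    obtain c' :: "nat \<Rightarrow> nat"
      where "\<And>k. k \<ge> 1 \<Longrightarrow> Defs.step (fseq f j) k = int (\<Sum>d | d dvd k. d * c' d)"
      using step_divisor_sum[OF c] by blast
    thus ?case using fseq_Suc[OF step(1)] by auto
  qed
  then obtain c :: "nat \<Rightarrow> nat" where "fseq f j 1 = int (\<Sum>d | d dvd 1. d * c d)" by blast
  hence "fseq f j 1 \<noteq> -1" by linarith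
  thus ?thesis by (auto simp: neg_one_fun_def)
qed

section \<open>Steps that do not fail\<close>

text \<open>Every failing branch returns the constant -1, so for a nonzero function any other result
  leaves only the branch that subtracts \<open>q * l\<close> on the multiples of
  \<open>l\<close>.\<close>

lemma step_success:
  assumes "\<not> zero_fun f" "\<not> neg_one_fun (step f)"
  defines "l \<equiv> least_pos f" and "q \<equiv> nat (f (least_pos f) div int (least_pos f))"
  shows "nonzero_fun f" "nonneg_fun f" "l \<ge> 1" "q \<ge> 1" "produces f l q"
    and "\<And>k. step f k = f k - (if l dvd k then int (q * l) else 0)"
proof -
  show nonzero: "nonzero_fun f"
    using assms(1) by (simp add: nonzero_fun_def zero_fun_def)
  show nonneg: "nonneg_fun f"
  proof (rule ccontr)
    assume "\<not> nonneg_fun f"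
    hence "step f = (\<lambda>_. -1)" by (auto simp: step_def nonneg_fun_def not_le)
    with assms(2) show False by (simp add: neg_one_fun_def)
  qed
  note l = least_posI[OF nonzero nonneg, folded l_def]
  show "l \<ge> 1" by (rule l(1))
  have mod: "f l mod int l = 0"
    using assms(1,2) nonneg unfolding step_def nonneg_fun_def neg_one_fun_def l_def Let_def
    by (auto split: if_splits)
  \<comment> \<open>\<open>f l\<close> is a positive multiple of \<open>l\<close>, so the conversion
    by \<open>nat\<close> in \<open>q\<close> loses nothing.\<close>
  have "f l div int l > 0"
    using mod l by (auto simp: pos_imp_zdiv_pos_iff intro: zdvd_imp_le)
  hence q: "int q = f l div int l" "q \<ge> 1"
    by (simp_all add: q_def l_def)
  show "q \<ge> 1" by (rule q(2))
  show "produces f l q"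
    using nonzero nonneg q mod by (auto simp: produces_def l_def[symmetric])
  show "step f k = f k - (if l dvd k then int (q * l) else 0)" for k
  proof -
    have "\<not> (\<exists>k\<ge>1. f k < 0)" using nonneg by (simp add: nonneg_fun_def not_less)
    hence eq: "step f = (if \<exists>d\<ge>1. f (d * l) - int q * int l < 0 then (\<lambda>_. -1)
        else (\<lambda>k. if k mod l = 0 then f k - int q * int l else f k))"
      using assms(1) mod q(1) unfolding step_def Let_def l_def[symmetric] by (simp only: if_False if_True simp_thms)
    moreover from this assms(2) have "\<not> (\<exists>d\<ge>1. f (d * l) - int q * int l < 0)"
      by (cases "\<exists>d\<ge>1. f (d * l) - int q * int l < 0") (simp_all only: if_True neg_one_fun_def simp_thms)
    ultimately show ?thesis by (simp only: if_False) (simp add: dvd_eq_mod_eq_0)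
  qed
qed

text \<open>Nothing positive survives up to \<open>least_pos f\<close>: below it \<open>f\<close> is
  zero and the step only subtracts, and at \<open>least_pos f\<close> itself the subtraction leaves
  0.\<close>

lemma least_pos_less_least_pos_step:
  assumes "\<not> zero_fun f" "\<not> neg_one_fun (step f)" "nonzero_fun (step f)" "nonneg_fun (step f)"
  shows "least_pos f < least_pos (step f)"
proof (rule ccontr)
  note s = step_success[OF assms(1,2)]
  note l' = least_posI[OF assms(3,4)]
  assume "\<not> least_pos f < least_pos (step f)"
  hence le: "least_pos (step f) \<le> least_pos f" by simp
  show False
  proof (cases "least_pos (step f) = least_pos f")
    case True
    hence "step f (least_pos f) = 0"
      using s(5) s(6)[of "least_pos f"] by (simp add: produces_def)
    with l'(2) True show False by simp
  next
    case False
    hence "f (least_pos (step f)) = 0"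
      using le l'(1) s(2) eq_0_if_less_least_pos by simp
    hence "step f (least_pos (step f)) \<le> 0" unfolding s(6) by simp
    with l'(2) show False by simp
  qed
qed

text \<open>A function with a negative value is sent to -1, so failure persists. By contraposition,
  one stage that has not failed vouches for all earlier ones.\<close>

lemma fseq_neg_one_fun_mono:
  assumes "neg_one_fun (fseq f i)" "1 \<le> i" "i \<le> j"
  shows "neg_one_fun (fseq f j)"
  using assms(3)
proof (induction rule: dec_induct)
  case (step j)
  have "Defs.step (fseq f j) = (\<lambda>_. -1)"
    using step(3) by (force simp: step_def neg_one_fun_def)
  thus ?case using fseq_Suc[of j f] step assms(2) by (simp add: neg_one_fun_def)
qed (rule assms)

section \<open>Unions of rotations\<close>

text \<open>
  The point \<open>(j, i, a)\<close> has position \<open>a\<close> on the \<open>i\<close>-th of the \<open>q j\<close> cycles of length \<open>l j\<close>.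
\<close>

definition rotation_points :: "nat set \<Rightarrow> (nat \<Rightarrow> nat) \<Rightarrow> (nat \<Rightarrow> nat) \<Rightarrow> (nat \<times> nat \<times> nat) set" where
  "rotation_points J l q = (SIGMA j:J. {..<q j} \<times> {..<l j})"

definition rotation :: "(nat \<Rightarrow> nat) \<Rightarrow> nat \<times> nat \<times> nat \<Rightarrow> nat \<times> nat \<times> nat" where
  "rotation l = (\<lambda>(j, i, a). (j, i, Suc a mod l j))"

text \<open>\<open>to_nat\<close> carries the triples into \<open>nat\<close>; outside their image
  the map is the identity, as \<open>permutes\<close> demands.\<close>

definition rotation_perm :: "nat set \<Rightarrow> (nat \<Rightarrow> nat) \<Rightarrow> (nat \<Rightarrow> nat) \<Rightarrow> nat \<Rightarrow> nat" where
  "rotation_perm J l q n =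
     (if n \<in> to_nat ` rotation_points J l q then to_nat (rotation l (from_nat n)) else n)"

lemma rotation_perm_funpow:
  assumes "(j, i, a) \<in> rotation_points J l q"
  shows "(rotation_perm J l q ^^ k) (to_nat (j, i, a)) = to_nat (j, i, (a + k) mod l j)"
proof (induction k)
  case 0
  then show ?case using assms by (auto simp: rotation_points_def)
next
  case (Suc k)
  have "(j, i, (a + k) mod l j) \<in> rotation_points J l q"
    using assms by (auto simp: rotation_points_def)
  thus ?case using Suc by (auto simp: rotation_perm_def rotation_def mod_Suc_eq)
qed

text \<open>On a cycle of length \<open>l j\<close> the power \<open>l j\<close> is the identity, so
  the power \<open>l j - 1\<close> acts as the inverse. This gives injectivity and
  surjectivity.\<close>

lemma rotation_perm_permutes:
  "rotation_perm J l q permutes to_nat ` rotation_points J l q" (is "?\<sigma> permutes ?X")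
proof (rule bij_imp_permutes)
  have pow: "(?\<sigma> ^^ l j) (to_nat (j, i, a)) = to_nat (j, i, a)"
    if "(j, i, a) \<in> rotation_points J l q" for j i a
    using rotation_perm_funpow[OF that] that by (auto simp: rotation_points_def)
  have in_X: "?\<sigma> x \<in> ?X" if "x \<in> ?X" for x
  proof -
    from that obtain j i a where x: "x = to_nat (j, i, a)" "(j, i, a) \<in> rotation_points J l q"
      by auto
    thus ?thesis
      using rotation_perm_funpow[OF x(2), of 1] by (auto simp: rotation_points_def)
  qed
  have pow_in: "(?\<sigma> ^^ n) x \<in> ?X" if "x \<in> ?X" for x n
    using that by (induction n) (auto intro: in_X simp del: image_iff)
  show "bij_betw ?\<sigma> ?X ?X"
  proof (rule bij_betw_imageI)
    show "inj_on ?\<sigma> ?X"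
    proof (rule inj_onI)
      fix x y assume xy: "x \<in> ?X" "y \<in> ?X" and eq: "?\<sigma> x = ?\<sigma> y"
      from xy obtain j i a j' i' a' where
        x: "x = to_nat (j, i, a)" "(j, i, a) \<in> rotation_points J l q" and
        y: "y = to_nat (j', i', a')" "(j', i', a') \<in> rotation_points J l q"
        by auto
      \<comment> \<open>The first component is preserved, so \<open>x\<close> and \<open>y\<close>
        lie on cycles of the same length and one exponent serves for both.\<close>
      have "j = j'"
        using eq rotation_perm_funpow[OF x(2), of 1] rotation_perm_funpow[OF y(2), of 1] x(1) y(1)
        by simp
      have "(?\<sigma> ^^ l j) x = (?\<sigma> ^^ l j) y"
        using eq x(2) by (cases "l j") (auto simp: rotation_points_def funpow_Suc_right simp del: funpow.simps)
      thus "x = y" using pow[OF x(2)] pow[OF y(2)] x(1) y(1) \<open>j = j'\<close> by simp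
    qed
    show "?\<sigma> ` ?X = ?X"
    proof
      show "?X \<subseteq> ?\<sigma> ` ?X"
      proof
        fix x assume "x \<in> ?X"
        then obtain j i a where x: "x = to_nat (j, i, a)" "(j, i, a) \<in> rotation_points J l q"
          by auto
        have "x = ?\<sigma> ((?\<sigma> ^^ (l j - 1)) x)"
          using pow[OF x(2)] x by (cases "l j") (auto simp: rotation_points_def)
        with pow_in[OF \<open>x \<in> ?X\<close>] show "x \<in> ?\<sigma> ` ?X" by blast
      qed
    qed (use in_X in blast)
  qed
qed (simp add: rotation_perm_def)

text \<open>A shift by \<open>k\<close> fixes all points of a cycle whose length divides
  \<open>k\<close> and no point of any other. Since \<open>k\<close> has finitely many divisors and
  \<open>l\<close> is injective, the sum is finite even for infinite \<open>J\<close>.\<close>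

lemma rotation_perm_num_fixpoints:
  assumes inj: "inj_on l J" and "k \<ge> 1"
  shows "num_fixpoints (to_nat ` rotation_points J l q) (rotation_perm J l q ^^ k) =
    enat (\<Sum>j | j \<in> J \<and> l j dvd k. q j * l j)"
proof -
  let ?K = "{j. j \<in> J \<and> l j dvd k}"
  have "finite (l ` ?K)"
    using \<open>k \<ge> 1\<close> by (rule_tac finite_subset[of _ "{d. d dvd k}"]) auto
  hence finK: "finite ?K"
    by (rule finite_imageD) (rule inj_on_subset[OF inj], blast)
  have fix_iff: "(a + k) mod m = a \<longleftrightarrow> m dvd k" if "a < m" for a m :: nat
  proof -
    have "(a + k) mod m = a \<longleftrightarrow> (a + k) mod m = a mod m" using that by simp
    also have "\<dots> \<longleftrightarrow> m dvd k" by (metis add_diff_cancel_left' le_add1 mod_eq_dvd_iff_nat)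
    finally show ?thesis .
  qed
  have "{x \<in> to_nat ` rotation_points J l q. (rotation_perm J l q ^^ k) x = x} =
      to_nat ` rotation_points ?K l q" (is "?F = _")
    using fix_iff by (auto simp: rotation_perm_funpow rotation_points_def)
  moreover have "finite (rotation_points ?K l q)"
    using finK by (auto simp: rotation_points_def)
  moreover have "card (rotation_points ?K l q) = (\<Sum>j\<in>?K. q j * l j)"
    using finK by (simp add: rotation_points_def)
  ultimately show ?thesis
    by (simp add: num_fixpoints_def ecard_finite card_image)
qed

text \<open>The orbit of \<open>(j, i, a)\<close> is the whole block of positions with this
  \<open>j\<close> and \<open>i\<close>, so the pairs \<open>(j, i)\<close> with
  \<open>l j = k\<close> parametrize the cycles of length \<open>k\<close>.\<close>

lemma rotation_perm_cycles:
  assumes pos: "\<And>j. j \<in> J \<Longrightarrow> l j \<ge> 1"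
  shows "{S. S \<subseteq> to_nat ` rotation_points J l q \<and> cyclic_on (rotation_perm J l q) S \<and> card S = k} =
    (\<lambda>(j, i). (\<lambda>a. to_nat (j, i, a)) ` {..<k}) ` (SIGMA j:{j \<in> J. l j = k}. {..<q j})"
    (is "{S. S \<subseteq> ?X \<and> cyclic_on ?\<sigma> S \<and> card S = k} = ?R")
proof -
  have orb: "orbit ?\<sigma> (to_nat (j, i, a)) = (\<lambda>b. to_nat (j, i, b)) ` {..<l j}"
    if "(j, i, a) \<in> rotation_points J l q" for j i a
  proof -
    have lj: "a < l j" using that by (auto simp: rotation_points_def)
    have "orbit ?\<sigma> (to_nat (j, i, a)) = {(?\<sigma> ^^ m) (to_nat (j, i, a)) | m. m < l j}"
      using rotation_perm_funpow[OF that, of "l j"] lj by (intro orbit_altdef_bounded) auto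
    also have "\<dots> = (\<lambda>b. to_nat (j, i, b)) ` {..<l j}"
    proof -
      have "\<exists>m<l j. b = (a + m) mod l j" if "b < l j" for b
      proof (cases "a \<le> b")
        case True
        with that lj show ?thesis by (intro exI[of _ "b - a"]) auto
      next
        case False
        \<comment> \<open>A position behind \<open>a\<close> is reached by passing the end of the
          cycle once.\<close>
        with that lj show ?thesis by (intro exI[of _ "b + l j - a"]) auto
      qed
      thus ?thesis using lj by (fastforce simp: rotation_perm_funpow[OF that])
    qed
    finally show ?thesis .
  qed
  have card: "card ((\<lambda>b. to_nat (j, i, b)) ` {..<n}) = n" for j i n :: nat
    by (subst card_image) (auto intro: inj_onI)
  show ?thesis
  proof (intro set_eqI iffI)
    fix S assume S: "S \<in> {S. S \<subseteq> ?X \<and> cyclic_on ?\<sigma> S \<and> card S = k}"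
    then obtain s where s: "s \<in> S" "S = orbit ?\<sigma> s" "s \<in> ?X"
      by (auto simp: cyclic_on_def)
    then obtain j i a where jia: "s = to_nat (j, i, a)" "(j, i, a) \<in> rotation_points J l q"
      by auto
    have eq: "S = (\<lambda>b. to_nat (j, i, b)) ` {..<l j}"
      using s(2) orb[OF jia(2)] jia(1) by simp
    hence "l j = k" using card S by simp
    thus "S \<in> ?R" using eq jia(2) by (auto simp: rotation_points_def intro!: image_eqI[of _ _ "(j, i)"])
  next
    fix S assume "S \<in> ?R"
    then obtain j i where ji: "j \<in> J" "l j = k" "i < q j" "S = (\<lambda>a. to_nat (j, i, a)) ` {..<l j}"
      by auto
    hence mem: "(j, i, 0) \<in> rotation_points J l q"
      using pos by (fastforce simp: rotation_points_def)
    have "S = orbit ?\<sigma> (to_nat (j, i, 0 :: nat))"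
      using orb[OF mem] ji(4) by simp
    moreover have "to_nat (j, i, 0 :: nat) \<in> S"
      using mem unfolding ji(4) rotation_points_def by blast
    ultimately
    have "cyclic_on ?\<sigma> S" by (auto simp: cyclic_on_def)
    moreover have "S \<subseteq> ?X" using ji by (auto simp: rotation_points_def)
    ultimately show "S \<in> {S. S \<subseteq> ?X \<and> cyclic_on ?\<sigma> S \<and> card S = k}"
      using card ji by simp
  qed
qed

text \<open>Injectivity of \<open>l\<close> leaves a single index \<open>j\<close> for each length
  that occurs, and the cycles of that length are told apart by \<open>i < q j\<close>.\<close>

lemma rotation_perm_num_cycles:
  assumes inj: "inj_on l J" and pos: "\<And>j. j \<in> J \<Longrightarrow> l j \<ge> 1"
  shows "j \<in> J \<Longrightarrow>
      num_cycles (to_nat ` rotation_points J l q) (rotation_perm J l q) (l j) = enat (q j)"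
    and "k \<notin> l ` J \<Longrightarrow> num_cycles (to_nat ` rotation_points J l q) (rotation_perm J l q) k = 0"
proof -
  assume j: "j \<in> J"
  hence J: "{j' \<in> J. l j' = l j} = {j}" using inj by (auto simp: inj_on_def)
  have "inj_on (\<lambda>(j', i). (\<lambda>a. to_nat (j', i, a)) ` {..<l j}) (SIGMA j':{j}. {..<q j'})"
  proof (rule inj_onI)
    fix x y assume "x \<in> (SIGMA j':{j}. {..<q j'})" "y \<in> (SIGMA j':{j}. {..<q j'})"
      and eq: "(\<lambda>(j', i). (\<lambda>a. to_nat (j', i, a)) ` {..<l j}) x =
        (\<lambda>(j', i). (\<lambda>a. to_nat (j', i, a)) ` {..<l j}) y"
    then obtain i i' where x: "x = (j, i)" and y: "y = (j, i')" by auto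
    \<comment> \<open>Equal blocks share the point at position 0, and decoding it yields
      \<open>i = i'\<close>. Position 0 exists because \<open>l j \<ge> 1\<close>.\<close>
    have "to_nat (j, i, 0 :: nat) \<in> (\<lambda>a. to_nat (j, i, a)) ` {..<l j}"
      using pos[OF j] by (intro imageI) auto
    with eq show "x = y" by (auto simp: x y)
  qed
  hence "card ((\<lambda>(j', i). (\<lambda>a. to_nat (j', i, a)) ` {..<l j}) ` (SIGMA j':{j}. {..<q j'})) = q j"
    by (simp add: card_image)
  thus "num_cycles (to_nat ` rotation_points J l q) (rotation_perm J l q) (l j) = enat (q j)"
    unfolding num_cycles_def by (subst rotation_perm_cycles) (use pos in \<open>simp_all add: J ecard_finite\<close>)
next
  assume "k \<notin> l ` J"
  hence J: "{j \<in> J. l j = k} = {}" by auto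
  show "num_cycles (to_nat ` rotation_points J l q) (rotation_perm J l q) k = 0"
    using pos unfolding num_cycles_def by (simp add: rotation_perm_cycles J ecard_def zero_enat_def)
qed

lemma finite_rotation_points:
  "finite J \<Longrightarrow> finite (rotation_points J l q)"
  by (auto simp: rotation_points_def)

lemma card_rotation_points:
  "finite J \<Longrightarrow> card (rotation_points J l q) = (\<Sum>j\<in>J. q j * l j)"
  by (simp add: rotation_points_def)

text \<open>Every index contributes the point \<open>(j, 0, 0)\<close>. Hence the set of points is
  nonempty if \<open>J\<close> is, and infinite if \<open>J\<close> is.\<close>

lemma fst_rotation_points:
  assumes "\<And>j. j \<in> J \<Longrightarrow> l j \<ge> 1 \<and> q j \<ge> 1"
  shows "fst ` rotation_points J l q = J"
proof -
  have "(j, 0, 0) \<in> rotation_points J l q" if "j \<in> J" for j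
    using assms[OF that] that by (auto simp: rotation_points_def)
  thus ?thesis by (force simp: rotation_points_def)
qed

section \<open>Iterating the construction\<close>

text \<open>The lengths, and below the multiplicities, as total functions of the stage; they carry
  meaning only at stages where the step succeeds.\<close>

definition fseq_l :: "(nat \<Rightarrow> int) \<Rightarrow> nat \<Rightarrow> nat" where
  "fseq_l f j = least_pos (fseq f j)"

definition fseq_q :: "(nat \<Rightarrow> int) \<Rightarrow> nat \<Rightarrow> nat" where
  "fseq_q f j = nat (fseq f j (fseq_l f j) div int (fseq_l f j))"

lemma fseq_success:
  assumes "j \<ge> 1" "\<not> zero_fun (fseq f j)" "\<not> neg_one_fun (fseq f (Suc j))"
  shows "nonzero_fun (fseq f j)" "nonneg_fun (fseq f j)" "fseq_l f j \<ge> 1" "fseq_q f j \<ge> 1"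
    "produces (fseq f j) (fseq_l f j) (fseq_q f j)"
    and "\<And>k. fseq f (Suc j) k =
           fseq f j k - (if fseq_l f j dvd k then int (fseq_q f j * fseq_l f j) else 0)"
  using step_success[of "fseq f j"] assms fseq_Suc[of j f]
  by (simp_all add: fseq_l_def fseq_q_def)

text \<open>Chains the growth over single steps. The hypothesis includes \<open>m = j\<close>
  because stage \<open>j\<close> too must be nonzero and nonnegative for its least length to
  exist.\<close>

lemma fseq_l_less:
  assumes "1 \<le> i" "i < j"
    and "\<And>m. 1 \<le> m \<Longrightarrow> m \<le> j \<Longrightarrow> \<not> zero_fun (fseq f m) \<and> \<not> neg_one_fun (fseq f (Suc m))"
  shows "fseq_l f i < fseq_l f j"
proof -
  have step: "fseq_l f m < fseq_l f (Suc m)" if "1 \<le> m" "Suc m \<le> j" for m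
    using least_pos_less_least_pos_step[of "fseq f m"] fseq_success(1,2)[of "Suc m" f]
      assms(3)[of m] assms(3)[of "Suc m"] that fseq_Suc[of m f]
    by (simp add: fseq_l_def)
  have "n \<le> j \<Longrightarrow> fseq_l f i < fseq_l f n" if "Suc i \<le> n" for n
    using that
  proof (induction n rule: dec_induct)
    case base
    show ?case using step[of i] assms(1,2) by simp
  next
    case (step n)
    with assms(1) \<open>\<And>m. 1 \<le> m \<Longrightarrow> Suc m \<le> j \<Longrightarrow> fseq_l f m < fseq_l f (Suc m)\<close>[of n]
    show ?case by simp
  qed
  with assms(2) show ?thesis by simp
qed

text \<open>The subtractions telescope: stage \<open>n\<close> differs from \<open>f\<close> by what
  the stages before it removed at \<open>k\<close>.\<close>

lemma fseq_eq_diff_sum: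
  assumes "1 \<le> n"
    and "\<And>m. 1 \<le> m \<Longrightarrow> m < n \<Longrightarrow> \<not> zero_fun (fseq f m) \<and> \<not> neg_one_fun (fseq f (Suc m))"
  shows "fseq f n k = f k - int (\<Sum>j | j \<in> {1..<n} \<and> fseq_l f j dvd k. fseq_q f j * fseq_l f j)"
  using assms
proof (induction n rule: dec_induct)
  case base
  show ?case by (simp add: fseq_1)
next
  case (step n)
  have "{j. j \<in> {1..<Suc n} \<and> fseq_l f j dvd k} =
      (if fseq_l f n dvd k then insert n else id) {j. j \<in> {1..<n} \<and> fseq_l f j dvd k}"
    using step(1) by (auto simp: less_Suc_eq)
  moreover have "fseq f n k =
      f k - int (\<Sum>j | j \<in> {1..<n} \<and> fseq_l f j dvd k. fseq_q f j * fseq_l f j)"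
    using step by simp
  ultimately show ?case
    using step fseq_success(6)[of n f k] by simp
qed

section \<open>Realising \<open>f\<close> by a permutation\<close>

text \<open>The sum in the hypothesis on \<open>f\<close> is the number of fixed points of the
  \<open>k\<close>-th power of the union of rotations with these lengths and multiplicities. An
  arbitrary nonempty initial segment \<open>J\<close> covers the terminating and the infinite
  construction at once.\<close>

lemma fseq_realised:
  fixes J :: "nat set"
  assumes J: "\<And>j. j \<in> J \<Longrightarrow> 1 \<le> j" "\<And>i j. 1 \<le> i \<Longrightarrow> i \<le> j \<Longrightarrow> j \<in> J \<Longrightarrow> i \<in> J" "J \<noteq> {}"
    and ok: "\<And>j. j \<in> J \<Longrightarrow> \<not> zero_fun (fseq f j) \<and> \<not> neg_one_fun (fseq f (Suc j))"
    and f: "\<And>k. k \<ge> 1 \<Longrightarrow>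
              f k = int (\<Sum>j | j \<in> J \<and> fseq_l f j dvd k. fseq_q f j * fseq_l f j)"
  shows "strict_mono_on J (fseq_l f)"
    and "\<exists>(X :: nat set) \<sigma>. fixed_point_counting_fun f X \<sigma> \<and> (finite X \<longleftrightarrow> finite J) \<and>
           (finite J \<longrightarrow> card X = (\<Sum>j\<in>J. fseq_q f j * fseq_l f j)) \<and>
           (\<forall>j\<in>J. num_cycles X \<sigma> (fseq_l f j) = enat (fseq_q f j)) \<and>
           (\<forall>k. k \<notin> fseq_l f ` J \<longrightarrow> num_cycles X \<sigma> k = 0)"
proof -
  show mono: "strict_mono_on J (fseq_l f)"
    using J ok by (intro strict_mono_onI fseq_l_less) auto
  hence inj: "inj_on (fseq_l f) J" by (rule strict_mono_on_imp_inj_on)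
  have pos: "fseq_l f j \<ge> 1 \<and> fseq_q f j \<ge> 1" if "j \<in> J" for j
    using fseq_success(3,4)[of j f] ok[OF that] J(1) that by auto
  define Y where "Y = rotation_points J (fseq_l f) (fseq_q f)"
  define X where "X = to_nat ` Y"
  define \<sigma> where "\<sigma> = rotation_perm J (fseq_l f) (fseq_q f)"
  have fst: "fst ` Y = J"
    unfolding Y_def using pos by (rule fst_rotation_points)
  have "finite X \<longleftrightarrow> finite Y"
    unfolding X_def by (simp add: finite_image_iff)
  also have "\<dots> \<longleftrightarrow> finite J"
    using fst finite_rotation_points unfolding Y_def by (metis finite_imageI)
  finally have "finite X \<longleftrightarrow> finite J" .
  moreover have "card X = (\<Sum>j\<in>J. fseq_q f j * fseq_l f j)" if "finite J"
    using card_rotation_points[OF that] by (simp add: X_def Y_def card_image)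
  moreover have "fixed_point_counting_fun f X \<sigma>"
    unfolding fixed_point_counting_fun_def
  proof (intro conjI allI impI)
    show "X \<noteq> {}" using fst J(3) by (auto simp: X_def)
    show "\<sigma> permutes X" unfolding \<sigma>_def X_def Y_def by (rule rotation_perm_permutes)
    fix k :: nat assume "k \<ge> 1"
    thus "\<exists>n. num_fixpoints X (\<sigma> ^^ k) = enat n \<and> f k = int n"
      unfolding \<sigma>_def X_def Y_def using rotation_perm_num_fixpoints[OF inj] f by blast
  qed simp
  moreover have "\<forall>j\<in>J. num_cycles X \<sigma> (fseq_l f j) = enat (fseq_q f j)"
    and "\<forall>k. k \<notin> fseq_l f ` J \<longrightarrow> num_cycles X \<sigma> k = 0"
    unfolding \<sigma>_def X_def Y_def using rotation_perm_num_cycles[OF inj] pos by blast+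
  ultimately show "\<exists>(X :: nat set) \<sigma>. fixed_point_counting_fun f X \<sigma> \<and> (finite X \<longleftrightarrow> finite J) \<and>
           (finite J \<longrightarrow> card X = (\<Sum>j\<in>J. fseq_q f j * fseq_l f j)) \<and>
           (\<forall>j\<in>J. num_cycles X \<sigma> (fseq_l f j) = enat (fseq_q f j)) \<and>
           (\<forall>k. k \<notin> fseq_l f ` J \<longrightarrow> num_cycles X \<sigma> k = 0)"
    by blast
qed

text \<open>Each increase is by at least 1. For the infinite construction this bounds the stages
  that can affect the value at a given \<open>k\<close>.\<close>

lemma strict_mono_on_atLeast_1_le:
  assumes "strict_mono_on {1::nat..} (l :: nat \<Rightarrow> nat)" "j \<ge> 1" "l 1 \<ge> 1"
  shows "j \<le> l j"
  using assms(2)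
proof (induction j rule: dec_induct)
  case (step n)
  have "l n < l (Suc n)"
    using strict_mono_onD[OF assms(1), of n "Suc n"] step(1) by simp
  with step show ?case by simp
qed (use assms in simp)

text \<open>Nonexistence is stated over an arbitrary type, existence over \<open>nat\<close>, into
  which every countable set can be encoded.\<close>

theorem mainTheorem4:
  fixes f :: "nat \<Rightarrow> int"
  assumes "nonzero_fun f"
  shows
    "((\<exists>j\<ge>1. neg_one_fun (fseq f j)) \<longrightarrow>
        \<not> (\<exists>(X :: 'a set) \<sigma>. fixed_point_counting_fun f X \<sigma>))
     \<and>
     (\<forall>r. (\<exists>j\<ge>1. zero_fun (fseq f j)) \<and> r = (LEAST j. j \<ge> 1 \<and> zero_fun (fseq f j)) \<longrightarrow>
        (\<exists>l q :: nat \<Rightarrow> nat.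
           (\<forall>j\<in>{1..<r}. l j \<ge> 1 \<and> q j \<ge> 1 \<and> produces (fseq f j) (l j) (q j)) \<and>
           strict_mono_on {1..<r} l \<and>
           (\<exists>(X :: nat set) \<sigma>.
              X \<noteq> {} \<and> finite X \<and> fixed_point_counting_fun f X \<sigma> \<and>
              card X = (\<Sum>j\<in>{1..<r}. q j * l j) \<and>
              (\<forall>j\<in>{1..<r}. num_cycles X \<sigma> (l j) = enat (q j)))))
     \<and>
     ((\<forall>j\<ge>1. \<not> zero_fun (fseq f j) \<and> \<not> neg_one_fun (fseq f j)) \<longrightarrow>
        (\<forall>j\<ge>1. nonzero_fun (fseq f j) \<and> nonneg_fun (fseq f j)) \<and>
        (\<exists>l q :: nat \<Rightarrow> nat.
           (\<forall>j\<ge>1. l j \<ge> 1 \<and> q j \<ge> 1 \<and> produces (fseq f j) (l j) (q j)) \<and>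
           strict_mono_on {1..} l \<and>
           (\<exists>(X :: nat set) \<sigma>.
              countable X \<and> infinite X \<and> fixed_point_counting_fun f X \<sigma> \<and>
              (\<forall>j\<ge>1. num_cycles X \<sigma> (l j) = enat (q j)) \<and>
              (\<forall>k\<ge>1. (\<forall>j\<ge>1. k \<noteq> l j) \<longrightarrow> num_cycles X \<sigma> k = 0))))"
proof (intro conjI impI allI)
  assume "\<exists>j\<ge>1. neg_one_fun (fseq f j)"
  thus "\<not> (\<exists>(X :: 'a set) \<sigma>. fixed_point_counting_fun f X \<sigma>)"
    using fixed_point_counting_fun_imp_not_neg_one_fun by blast
next
  fix r assume *: "(\<exists>j\<ge>1. zero_fun (fseq f j)) \<and> r = (LEAST j. j \<ge> 1 \<and> zero_fun (fseq f j))"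
  have r: "r \<ge> 1" "zero_fun (fseq f r)"
    using LeastI_ex[OF conjunct1[OF *]] * by simp_all
  have least: "\<not> zero_fun (fseq f j)" if "1 \<le> j" "j < r" for j
    using not_less_Least[of j "\<lambda>j. j \<ge> 1 \<and> zero_fun (fseq f j)"] * that by simp
  have "\<not> neg_one_fun (fseq f r)"
    using r(2) by (auto simp: neg_one_fun_def zero_fun_def)
  \<comment> \<open>A failure before stage \<open>r\<close> would persist up to \<open>r\<close>,
    where the function is zero and not -1.\<close>
  hence ok: "\<not> zero_fun (fseq f j) \<and> \<not> neg_one_fun (fseq f (Suc j))" if "1 \<le> j" "j < r" for j
    using least[OF that] fseq_neg_one_fun_mono[of f "Suc j" r] that by auto
  have "r \<noteq> 1"
    using assms r(2) by (auto simp: nonzero_fun_def zero_fun_def fseq_1)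
  hence ne: "{1..<r} \<noteq> {}" using r(1) by auto
  \<comment> \<open>Stage \<open>r\<close> vanishes, so the telescoped sum is all of
    \<open>f\<close>.\<close>
  have f: "f k = int (\<Sum>j | j \<in> {1..<r} \<and> fseq_l f j dvd k. fseq_q f j * fseq_l f j)"
    if "k \<ge> 1" for k
    using fseq_eq_diff_sum[OF r(1) ok, of k] r(2) that by (simp add: zero_fun_def)
  have "strict_mono_on {1..<r} (fseq_l f)"
    by (rule fseq_realised(1)) (use ok f ne in auto)
  moreover obtain X :: "nat set" and \<sigma> where "fixed_point_counting_fun f X \<sigma>" "finite X"
    "card X = (\<Sum>j\<in>{1..<r}. fseq_q f j * fseq_l f j)"
    "\<forall>j\<in>{1..<r}. num_cycles X \<sigma> (fseq_l f j) = enat (fseq_q f j)"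
    using fseq_realised(2)[of "{1..<r}" f] ok f ne by auto
  moreover from this(1) have "X \<noteq> {}" by (simp add: fixed_point_counting_fun_def)
  moreover have "\<forall>j\<in>{1..<r}. fseq_l f j \<ge> 1 \<and> fseq_q f j \<ge> 1 \<and>
      produces (fseq f j) (fseq_l f j) (fseq_q f j)"
    using fseq_success(3-5) ok by simp
  ultimately show "\<exists>l q :: nat \<Rightarrow> nat.
           (\<forall>j\<in>{1..<r}. l j \<ge> 1 \<and> q j \<ge> 1 \<and> produces (fseq f j) (l j) (q j)) \<and>
           strict_mono_on {1..<r} l \<and>
           (\<exists>(X :: nat set) \<sigma>.
              X \<noteq> {} \<and> finite X \<and> fixed_point_counting_fun f X \<sigma> \<and>
              card X = (\<Sum>j\<in>{1..<r}. q j * l j) \<and>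
              (\<forall>j\<in>{1..<r}. num_cycles X \<sigma> (l j) = enat (q j)))"
    by blast
next
  assume *: "\<forall>j\<ge>1. \<not> zero_fun (fseq f j) \<and> \<not> neg_one_fun (fseq f j)"
  hence ok: "\<not> zero_fun (fseq f j) \<and> \<not> neg_one_fun (fseq f (Suc j))" if "1 \<le> j" for j
    using that by simp
  note succ = fseq_success[OF _ conjunct1[OF ok] conjunct2[OF ok]]
  show "nonzero_fun (fseq f j)" "nonneg_fun (fseq f j)" if "j \<ge> 1" for j
    using succ(1,2) that by auto
  have mono: "strict_mono_on {1..} (fseq_l f)"
    using ok by (intro strict_mono_onI fseq_l_less) auto
  have le: "j \<le> fseq_l f j" if "j \<ge> 1" for j
    using strict_mono_on_atLeast_1_le[OF mono that] succ(3)[of 1] by simp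
  have f: "f k = int (\<Sum>j | j \<in> {1..} \<and> fseq_l f j dvd k. fseq_q f j * fseq_l f j)"
    if "k \<ge> 1" for k
  proof -
    \<comment> \<open>Stage \<open>k + 1\<close> has its least length beyond \<open>k\<close>, so it
      vanishes at \<open>k\<close>: everything at \<open>k\<close> has been subtracted by
      then.\<close>
    have "k < fseq_l f (Suc k)" using le[of "Suc k"] by simp
    hence "fseq f (Suc k) k = 0"
      using eq_0_if_less_least_pos[OF succ(2)[of "Suc k"], of k] that by (simp add: fseq_l_def)
    \<comment> \<open>A later stage \<open>j > k\<close> has length at least \<open>j\<close>, too
      large to divide \<open>k\<close>.\<close>
    moreover have "{j. j \<in> {1..} \<and> fseq_l f j dvd k} = {j. j \<in> {1..<Suc k} \<and> fseq_l f j dvd k}"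
      using le that by (fastforce dest: dvd_imp_le)
    ultimately show ?thesis
      using fseq_eq_diff_sum[of "Suc k" f k] ok by simp
  qed
  obtain X :: "nat set" and \<sigma> where "fixed_point_counting_fun f X \<sigma>" "infinite X"
    "\<forall>j\<in>{1..}. num_cycles X \<sigma> (fseq_l f j) = enat (fseq_q f j)"
    "\<forall>k. k \<notin> fseq_l f ` {1..} \<longrightarrow> num_cycles X \<sigma> k = 0"
    using fseq_realised(2)[of "{1..}" f] ok f by (auto simp: infinite_Ici)
  hence X: "countable X \<and> infinite X \<and> fixed_point_counting_fun f X \<sigma> \<and>
      (\<forall>j\<ge>1. num_cycles X \<sigma> (fseq_l f j) = enat (fseq_q f j)) \<and>
      (\<forall>k\<ge>1. (\<forall>j\<ge>1. k \<noteq> fseq_l f j) \<longrightarrow> num_cycles X \<sigma> k = 0)"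
    by auto
  have "\<forall>j\<ge>1. fseq_l f j \<ge> 1 \<and> fseq_q f j \<ge> 1 \<and> produces (fseq f j) (fseq_l f j) (fseq_q f j)"
    using succ(3-5) by simp
  with mono X show "\<exists>l q :: nat \<Rightarrow> nat.
           (\<forall>j\<ge>1. l j \<ge> 1 \<and> q j \<ge> 1 \<and> produces (fseq f j) (l j) (q j)) \<and>
           strict_mono_on {1..} l \<and>
           (\<exists>(X :: nat set) \<sigma>.
              countable X \<and> infinite X \<and> fixed_point_counting_fun f X \<sigma> \<and>
              (\<forall>j\<ge>1. num_cycles X \<sigma> (l j) = enat (q j)) \<and>
              (\<forall>k\<ge>1. (\<forall>j\<ge>1. k \<noteq> l j) \<longrightarrow> num_cycles X \<sigma> k = 0))"
    by blast
qed

end
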